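(* $A_{\text{gen}}(n) = O(n^{\log_2 7})$ as $n \to \infty$.
   Context: For a finite set $\mathcal P \subset \mathbb{R}^2$, $A(\mathcal P)$ denotes the number of distinct values in the open interval $(0,\pi)$ of angles $\angle pqr$ with $p,q,r$ distinct points of $\mathcal P$ (angles of $0$ and $\pi$ are not counted). A planar point set is in general position if no three of its points are collinear and no four of its points lie on a common circle. $A_{\text{gen}}(n)$ is the minimum of $A(\mathcal P)$ over all sets $\mathcal P \subset \mathbb{R}^2$ of $n$ points in general position. $f = O(g)$ means there is a constant $C$ with $f(n) \le C g(n)$ for all sufficiently large $n$. *)

theory Defs
  imports "HOL-Analysis.Analysis" "HOL-Library.Landau_Symbols"
begin

(* Unoriented angle at the vertex q; only meaningful for p \<noteq> q and r \<noteq> q. *)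
definition angle :: "real^2 \<Rightarrow> real^2 \<Rightarrow> real^2 \<Rightarrow> real" where
  "angle p q r = arccos (((p - q) \<bullet> (r - q)) / (norm (p - q) * norm (r - q)))"

definition angle_set :: "(real^2) set \<Rightarrow> real set" where
  "angle_set P =
     {angle p q r | p q r. p \<in> P \<and> q \<in> P \<and> r \<in> P \<and> p \<noteq> q \<and> q \<noteq> r \<and> p \<noteq> r} \<inter> {0<..<pi}"

definition num_angles :: "(real^2) set \<Rightarrow> nat" where
  "num_angles P = card (angle_set P)"

definition general_position :: "(real^2) set \<Rightarrow> bool" where
  "general_position P \<longleftrightarrow>
     (\<forall>T. T \<subseteq> P \<and> card T = 3 \<longrightarrow> \<not> collinear T) \<and>
     (\<forall>T. T \<subseteq> P \<and> card T = 4 \<longrightarrow> \<not> (\<exists>c \<rho>. \<rho> > 0 \<and> T \<subseteq> sphere c \<rho>))"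

(* The infimum of a nonempty set of naturals is its minimum. The set here is never empty:
   finitely many lines and circles do not cover the plane, so a finite set in general
   position can always be extended by one point. *)
definition A_gen :: "nat \<Rightarrow> nat" where
  "A_gen n = Inf {num_angles P | P. finite P \<and> card P = n \<and> general_position P}"

end

theory Submission
  imports Defs
begin

text \<open>
  Replacing a set P by P \<union> (P + v) doubles its size and multiplies the number of pairs
  (p - q, r - q), which determine the angles, by at most 7: if the three points carry the
  shifts i, j, k \<in> {0, 1}, the pair changes by ((i - j) v, (k - j) v), and (i - j, k - j) takes
  7 values. For v = t u, collinearity of three and concyclicity of four points of the new set
  are polynomial equations of degree at most 2 in t, which for all but finitely many directions u
  are nontrivial; hence some v preserves general position. Starting from one point this gives
  2^d points with at most 7^d angles.
\<close>

section \<open>Determinants for collinearity and concyclicity\<close>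

definition cross2 :: "real^2 \<Rightarrow> real^2 \<Rightarrow> real" where
  "cross2 a b = a$1 * b$2 - a$2 * b$1"

definition collinear_det :: "real^2 \<Rightarrow> real^2 \<Rightarrow> real^2 \<Rightarrow> real" where
  "collinear_det p q r = cross2 (q - p) (r - p)"

text \<open>The in-circle determinant with base point \<open>p\<close>: rows (|x - p|^2, x - p) for
  x = q, r, s, expanded along the column of squared lengths.\<close>

definition concyclic_det :: "real^2 \<Rightarrow> real^2 \<Rightarrow> real^2 \<Rightarrow> real^2 \<Rightarrow> real" where
  "concyclic_det p q r s =
     ((q - p) \<bullet> (q - p)) * cross2 (r - p) (s - p) -
     ((r - p) \<bullet> (r - p)) * cross2 (q - p) (s - p) +
     ((s - p) \<bullet> (s - p)) * cross2 (q - p) (r - p)"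

text \<open>Written with polynomial inequations so that a good shift can be found by counting
  roots.\<close>

definition det_general_position :: "(real^2) set \<Rightarrow> bool" where
  "det_general_position P \<longleftrightarrow>
     (\<forall>p\<in>P. \<forall>q\<in>P. \<forall>r\<in>P. distinct [p, q, r] \<longrightarrow> collinear_det p q r \<noteq> 0) \<and>
     (\<forall>p\<in>P. \<forall>q\<in>P. \<forall>r\<in>P. \<forall>s\<in>P. distinct [p, q, r, s] \<longrightarrow> concyclic_det p q r s \<noteq> 0)"

text \<open>Degenerate triples are kept: distinct points of the doubled set may come from the same
  point of \<open>P\<close>.\<close>

definition difference_pairs :: "'a::ab_group_add set \<Rightarrow> ('a \<times> 'a) set" where
  "difference_pairs P = (\<lambda>(p, q, r). (p - q, r - q)) ` (P \<times> P \<times> P)"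

lemma inner_real2: "a \<bullet> b = a$1 * b$1 + a$2 * b$2" for a b :: "real^2"
  by (simp add: inner_vec_def sum_2)

lemmas coordinates = collinear_det_def concyclic_det_def cross2_def inner_real2

lemma collinear_det_eq_0:
  assumes "collinear {p, q, r}"
  shows "collinear_det p q r = 0"
proof -
  from assms obtain u where u: "\<forall>x\<in>{p, q, r}. \<forall>y\<in>{p, q, r}. \<exists>c. x - y = c *\<^sub>R u"
    unfolding collinear_def by blast
  then obtain a b where "q - p = a *\<^sub>R u" "r - p = b *\<^sub>R u" by blast
  then show ?thesis by (simp add: collinear_det_def cross2_def)
qed

text \<open>Relative to the point \<open>p\<close> of the circle, |x - p|^2 is the linear form 2 (x
  - p) . (c - p), so the column of squared lengths depends linearly on the two coordinate
  columns.\<close>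

lemma concyclic_det_eq_0:
  assumes "{p, q, r, s} \<subseteq> sphere c \<rho>"
  shows "concyclic_det p q r s = 0"
proof -
  have eq: "(x - p) \<bullet> (x - p) = 2 * ((x - p) \<bullet> (c - p))" if "x \<in> {p, q, r, s}" for x
  proof -
    have "norm (c - x) = norm (c - p)" using assms that by (auto simp: dist_norm)
    then have "(c - x) \<bullet> (c - x) = (c - p) \<bullet> (c - p)" by (simp add: norm_eq)
    then show ?thesis by (simp add: algebra_simps inner_commute)
  qed
  have "concyclic_det p q r s =
     2 * ((q - p) \<bullet> (c - p)) * cross2 (r - p) (s - p) -
     2 * ((r - p) \<bullet> (c - p)) * cross2 (q - p) (s - p) +
     2 * ((s - p) \<bullet> (c - p)) * cross2 (q - p) (r - p)"
    unfolding concyclic_det_def by (simp only: eq insert_iff simp_thms)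
  also have "\<dots> = 0"
    unfolding cross2_def inner_real2 by algebra
  finally show ?thesis .
qed

lemma card_4_obtain:
  assumes "card T = 4"
  obtains p q r s where "T = {p, q, r, s}" "distinct [p, q, r, s]"
proof -
  have "card T = Suc 3" using assms by simp
  then obtain p B where B: "T = insert p B" "p \<notin> B" "card B = 3"
    unfolding card_Suc_eq by blast
  then obtain q r s where "B = {q, r, s}" "q \<noteq> r" "r \<noteq> s" "q \<noteq> s"
    unfolding card_3_iff by blast
  then show ?thesis using B by (intro that[of p q r s]) simp_all
qed

lemma det_general_position_imp:
  assumes "det_general_position P"
  shows "general_position P"
  unfolding general_position_def
proof (intro conjI allI impI; elim conjE)
  fix T assume T: "T \<subseteq> P" "card T = 3"
  then obtain p q r where "T = {p, q, r}" "distinct [p, q, r]"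
    unfolding card_3_iff by auto
  then show "\<not> collinear T"
    using assms T collinear_det_eq_0 unfolding det_general_position_def by blast
next
  fix T assume T: "T \<subseteq> P" "card T = 4"
  from card_4_obtain[OF T(2)] obtain p q r s where "T = {p, q, r, s}" "distinct [p, q, r, s]" .
  moreover from this have "concyclic_det p q r s \<noteq> 0"
    using assms T unfolding det_general_position_def by simp
  ultimately show "\<not> (\<exists>c \<rho>. \<rho> > 0 \<and> T \<subseteq> sphere c \<rho>)"
    using concyclic_det_eq_0 by metis
qed

section \<open>Roots of quadratics and symmetries of the determinants\<close>

lemma finite_roots_quadratic:
  fixes f :: "real \<Rightarrow> real"
  assumes "\<And>t. f t = a + b * t + c * t\<^sup>2" and "b \<noteq> 0 \<or> c \<noteq> 0"
  shows "finite {t. f t = 0}"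
proof -
  have "finite {t. poly [:a, b, c:] t = 0}"
    by (rule poly_roots_finite) (use assms(2) in auto)
  moreover have "poly [:a, b, c:] t = f t" for t
    by (simp add: assms(1) power2_eq_square algebra_simps)
  ultimately show ?thesis by simp
qed

lemma collinear_det_perm:
  "collinear_det q p r = - collinear_det p q r"
  "collinear_det p r q = - collinear_det p q r"
  unfolding coordinates by (simp_all add: algebra_simps)

text \<open>These adjacent transpositions generate all reorderings. Alternation in the base point
  \<open>p\<close> comes from the equivalent 4x4 determinant with rows (1, x, |x|^2).\<close>

lemma concyclic_det_perm:
  "concyclic_det q p r s = - concyclic_det p q r s"
  "concyclic_det p r q s = - concyclic_det p q r s"
  "concyclic_det p q s r = - concyclic_det p q r s"
  unfolding coordinates vector_minus_component by algebra+

lemma collinear_det_translate: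
  "collinear_det (p + v) (q + v) (r + v) = collinear_det p q r"
  by (simp add: collinear_det_def)

lemma concyclic_det_translate:
  "concyclic_det (p + v) (q + v) (r + v) (s + v) = concyclic_det p q r s"
  by (simp add: concyclic_det_def)

section \<open>Choice of a generic direction\<close>

text \<open>
  In complex notation this is the imaginary part of u^2 times the conjugate of q e;
  it is the leading coefficient of the concyclicity determinant of two points with difference q
  and two points with difference e translated by a large multiple of u.
\<close>
definition direction_det :: "real^2 \<Rightarrow> real^2 \<Rightarrow> real^2 \<Rightarrow> real" where
  "direction_det u q e = 2 * (u \<bullet> e) * cross2 q u - (u \<bullet> u) * cross2 q e"

lemma finite_bad_slopes:
  assumes "q \<noteq> 0" "e \<noteq> 0"
  shows "finite {x. direction_det (vector [1, x]) q e = 0}"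
proof (rule finite_roots_quadratic)
  show "direction_det (vector [1, x]) q e = - (q$1 * e$2 + q$2 * e$1)
      + 2 * (q$1 * e$1 - q$2 * e$2) * x + (q$1 * e$2 + q$2 * e$1) * x\<^sup>2" for x
    by (simp add: direction_det_def cross2_def inner_real2 power2_eq_square algebra_simps)
  \<comment> \<open>The two squared terms are the real and imaginary parts of the complex product q
    e, and |q e| = |q| |e|; so they cannot both vanish.\<close>
  have "(q$1 * e$1 - q$2 * e$2)\<^sup>2 + (q$1 * e$2 + q$2 * e$1)\<^sup>2 = (q \<bullet> q) * (e \<bullet> e)"
    by (simp add: inner_real2 power2_eq_square algebra_simps)
  also have "\<dots> \<noteq> 0" using assms by simp
  finally show "2 * (q$1 * e$1 - q$2 * e$2) \<noteq> 0 \<or> q$1 * e$2 + q$2 * e$1 \<noteq> 0" by auto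
qed

lemma exists_generic_direction:
  assumes "finite D" "0 \<notin> D"
  obtains u where "u \<noteq> 0" "\<And>q e. q \<in> D \<Longrightarrow> e \<in> D \<Longrightarrow> direction_det u q e \<noteq> 0"
proof -
  have "finite (\<Union>q\<in>D. \<Union>e\<in>D. {x. direction_det (vector [1, x]) q e = 0})"
    using assms by (intro finite_UN_I finite_bad_slopes) auto
  then obtain x where x: "x \<notin> (\<Union>q\<in>D. \<Union>e\<in>D. {x. direction_det (vector [1, x]) q e = 0})"
    using ex_new_if_finite infinite_UNIV_char_0 by blast
  have "(vector [1, x] :: real^2) $ 1 = 1" by simp
  then have "(vector [1, x] :: real^2) \<noteq> 0" by (metis zero_index zero_neq_one)
  then show ?thesis using that x by blast
qed

section \<open>Bad shift lengths in a fixed direction\<close>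

lemma finite_shift_meets:
  fixes u :: "'a::real_inner"
  assumes "u \<noteq> 0"
  shows "finite {t. p = r + t *\<^sub>R u}"
proof (rule finite_subset)
  show "{t. p = r + t *\<^sub>R u} \<subseteq> {((p - r) \<bullet> u) / (u \<bullet> u)}"
    using assms by auto
qed simp

lemma finite_shift_collinear:
  assumes "cross2 (q - p) u \<noteq> 0"
  shows "finite {t. collinear_det p q (r + t *\<^sub>R u) = 0}"
proof (rule finite_roots_quadratic)
  show "collinear_det p q (r + t *\<^sub>R u) = collinear_det p q r + cross2 (q - p) u * t + 0 * t\<^sup>2" for t
    by (simp add: coordinates algebra_simps)
qed (use assms in simp)

lemma finite_shift_concyclic1:
  assumes "u \<noteq> 0" "collinear_det p q r \<noteq> 0"
  shows "finite {t. concyclic_det p q r (s + t *\<^sub>R u) = 0}"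
proof (rule finite_roots_quadratic)
  let ?f = "\<lambda>t. concyclic_det p q r (s + t *\<^sub>R u)" and ?c = "(u \<bullet> u) * collinear_det p q r"
  \<comment> \<open>Only the squared length of the moving point is quadratic in \<open>t\<close>;
    its cofactor gives \<open>?c\<close>. The linear coefficient is read off from the values at 0
    and 1.\<close>
  show "?f t = ?f 0 + (?f 1 - ?f 0 - ?c) * t + ?c * t\<^sup>2" for t
    unfolding coordinates vector_minus_component vector_add_component vector_scaleR_component
      real_scaleR_def by algebra
qed (use assms in auto)

text \<open>The two cubic terms are opposite multiples of (u . u) \<open>cross2 (q - p) u\<close>
  and cancel, leaving a quadratic with leading coefficient
  \<open>direction_det u (q - p) (s - r)\<close>.\<close>

lemma finite_shift_concyclic2:
  assumes "direction_det u (q - p) (s - r) \<noteq> 0"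
  shows "finite {t. concyclic_det p q (r + t *\<^sub>R u) (s + t *\<^sub>R u) = 0}"
proof (rule finite_roots_quadratic)
  let ?f = "\<lambda>t. concyclic_det p q (r + t *\<^sub>R u) (s + t *\<^sub>R u)"
    and ?c = "direction_det u (q - p) (s - r)"
  show "?f t = ?f 0 + (?f 1 - ?f 0 - ?c) * t + ?c * t\<^sup>2" for t
    unfolding coordinates direction_det_def vector_minus_component vector_add_component
      vector_scaleR_component real_scaleR_def by algebra
qed (use assms in simp)

section \<open>Existence of a generic shift\<close>

text \<open>
  The shift -v accounts for the configurations in which a single point is not shifted.
\<close>
definition generic_shift :: "(real^2) set \<Rightarrow> real^2 \<Rightarrow> bool" where
  "generic_shift P v \<longleftrightarrow>
     (\<forall>p\<in>P. \<forall>r\<in>P. p \<noteq> r + v) \<and>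
     (\<forall>p\<in>P. \<forall>q\<in>P. \<forall>r\<in>P. p \<noteq> q \<longrightarrow>
        collinear_det p q (r + v) \<noteq> 0 \<and> collinear_det p q (r - v) \<noteq> 0) \<and>
     (\<forall>p\<in>P. \<forall>q\<in>P. \<forall>r\<in>P. \<forall>s\<in>P. distinct [p, q, r] \<longrightarrow>
        concyclic_det p q r (s + v) \<noteq> 0 \<and> concyclic_det p q r (s - v) \<noteq> 0) \<and>
     (\<forall>p\<in>P. \<forall>q\<in>P. \<forall>r\<in>P. \<forall>s\<in>P. p \<noteq> q \<and> r \<noteq> s \<longrightarrow>
        concyclic_det p q (r + v) (s + v) \<noteq> 0)"

lemma exists_generic_shift:
  assumes "finite P" "det_general_position P"
  obtains v where "generic_shift P v"
proof -
  define D where "D = (\<lambda>(p, q). q - p) ` (P \<times> P) - {0}"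
  have "finite D" "0 \<notin> D" using assms by (auto simp: D_def)
  then obtain u where "u \<noteq> 0" and u: "\<And>q e. q \<in> D \<Longrightarrow> e \<in> D \<Longrightarrow> direction_det u q e \<noteq> 0"
    using exists_generic_direction by blast
  have D: "q - p \<in> D" if "p \<in> P" "q \<in> P" "p \<noteq> q" for p q
    using that by (force simp: D_def)
  \<comment> \<open>Taking both differences equal to q - p makes the second term of
    \<open>direction_det\<close> vanish, so \<open>cross2 (q - p) u\<close> is a factor of the
    nonzero value.\<close>
  have cross: "cross2 (q - p) u \<noteq> 0" if "p \<in> P" "q \<in> P" "p \<noteq> q" for p q
    using u[OF D[OF that] D[OF that]] by (auto simp: direction_det_def cross2_def)
  \<comment> \<open>\<open>C \<delta> t\<close> collects the conditions for the shift by
    \<open>t\<close> along \<open>\<delta>\<close>. One \<open>t\<close> good for both u and -u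
    settles the shifts v and -v together.\<close>
  define C where "C \<delta> t \<longleftrightarrow>
     (\<forall>p\<in>P. \<forall>r\<in>P. p \<noteq> r + t *\<^sub>R \<delta>) \<and>
     (\<forall>p\<in>P. \<forall>q\<in>P. \<forall>r\<in>P. p \<noteq> q \<longrightarrow> collinear_det p q (r + t *\<^sub>R \<delta>) \<noteq> 0) \<and>
     (\<forall>p\<in>P. \<forall>q\<in>P. \<forall>r\<in>P. \<forall>s\<in>P. distinct [p, q, r] \<longrightarrow> concyclic_det p q r (s + t *\<^sub>R \<delta>) \<noteq> 0) \<and>
     (\<forall>p\<in>P. \<forall>q\<in>P. \<forall>r\<in>P. \<forall>s\<in>P. p \<noteq> q \<and> r \<noteq> s \<longrightarrow>
        concyclic_det p q (r + t *\<^sub>R \<delta>) (s + t *\<^sub>R \<delta>) \<noteq> 0)" for \<delta> t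
  have fin: "finite {t. \<not> C \<delta> t}" if \<delta>: "\<delta> = u \<or> \<delta> = - u" for \<delta>
  proof -
    have 1: "\<delta> \<noteq> 0" using \<delta> \<open>u \<noteq> 0\<close> by auto
    have 2: "cross2 (q - p) \<delta> \<noteq> 0" if "p \<in> P" "q \<in> P" "p \<noteq> q" for p q
      using cross[OF that] \<delta> by (auto simp: cross2_def)
    have 3: "direction_det \<delta> (q - p) (s - r) \<noteq> 0"
      if "p \<in> P" "q \<in> P" "r \<in> P" "s \<in> P" "p \<noteq> q" "r \<noteq> s" for p q r s
    proof -
      have "direction_det (- u) (q - p) (s - r) = direction_det u (q - p) (s - r)"
        by (simp add: direction_det_def cross2_def inner_real2 algebra_simps)
      then show ?thesis using u D that \<delta> by auto
    qed
    have "{t. \<not> C \<delta> t} \<subseteq>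
       (\<Union>p\<in>P. \<Union>r\<in>P. {t. p = r + t *\<^sub>R \<delta>}) \<union>
       (\<Union>p\<in>P. \<Union>q\<in>P - {p}. \<Union>r\<in>P. {t. collinear_det p q (r + t *\<^sub>R \<delta>) = 0}) \<union>
       (\<Union>p\<in>P. \<Union>q\<in>P - {p}. \<Union>r\<in>P - {p, q}. \<Union>s\<in>P. {t. concyclic_det p q r (s + t *\<^sub>R \<delta>) = 0}) \<union>
       (\<Union>p\<in>P. \<Union>q\<in>P - {p}. \<Union>r\<in>P. \<Union>s\<in>P - {r}.
          {t. concyclic_det p q (r + t *\<^sub>R \<delta>) (s + t *\<^sub>R \<delta>) = 0})"
      (is "_ \<subseteq> ?B")
      unfolding C_def by auto
    moreover have "finite ?B"
      using assms 1 2 3 unfolding det_general_position_def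
      by (intro finite_UnI finite_UN_I finite_shift_meets finite_shift_collinear
          finite_shift_concyclic1 finite_shift_concyclic2) auto
    ultimately show ?thesis by (rule finite_subset)
  qed
  have "finite ({t. \<not> C u t} \<union> {t. \<not> C (- u) t})" using fin by simp
  then obtain t where "t \<notin> {t. \<not> C u t} \<union> {t. \<not> C (- u) t}"
    using ex_new_if_finite infinite_UNIV_char_0 by blast
  then have "C u t" "C (- u) t" by auto
  then have "generic_shift P (t *\<^sub>R u)"
    unfolding C_def generic_shift_def by simp
  then show ?thesis by (rule that)
qed

section \<open>General position of the doubled set\<close>

text \<open>Case split on which points are shifted. Alternation reduces to one order per number of
  shifted points; translating by -v handles a single unshifted point. The original points behind the
  two copies may coincide, as in the parallelogram p, q, p + v, q + v.\<close>

lemma det_general_position_double: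
  assumes gp: "det_general_position P" and v: "generic_shift P v"
  shows "det_general_position (P \<union> (\<lambda>p. p + v) ` P)"
proof -
  note v = v[unfolded generic_shift_def] and gp = gp[unfolded det_general_position_def]
  have col3: "collinear_det p q r \<noteq> 0" if "p \<in> P" "q \<in> P" "r \<in> P" "distinct [p, q, r]" for p q r
    using gp that by blast
  have col21: "collinear_det p q (r + v) \<noteq> 0" "collinear_det p (r + v) q \<noteq> 0"
      "collinear_det (r + v) p q \<noteq> 0"
    and col12: "collinear_det (p + v) (q + v) r \<noteq> 0" "collinear_det (p + v) r (q + v) \<noteq> 0"
      "collinear_det r (p + v) (q + v) \<noteq> 0"
    if "p \<in> P" "q \<in> P" "r \<in> P" "p \<noteq> q" for p q r
  proof -
    show 1: "collinear_det p q (r + v) \<noteq> 0" using v that by blast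
    then show 2: "collinear_det p (r + v) q \<noteq> 0"
      using collinear_det_perm(2)[of p q "r + v"] by simp
    then show "collinear_det (r + v) p q \<noteq> 0"
      using collinear_det_perm(1)[of p "r + v" q] by simp
    have "collinear_det p q (r - v) \<noteq> 0" using v that by blast
    then show 3: "collinear_det (p + v) (q + v) r \<noteq> 0"
      using collinear_det_translate[of p v q "r - v"] by simp
    then show 4: "collinear_det (p + v) r (q + v) \<noteq> 0"
      using collinear_det_perm(2)[of "p + v" "q + v" r] by simp
    then show "collinear_det r (p + v) (q + v) \<noteq> 0"
      using collinear_det_perm(1)[of "p + v" r "q + v"] by simp
  qed
  have con4: "concyclic_det p q r s \<noteq> 0"
    if "p \<in> P" "q \<in> P" "r \<in> P" "s \<in> P" "distinct [p, q, r, s]" for p q r s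
    using gp that by blast
  have move_last: "concyclic_det p q z r \<noteq> 0" "concyclic_det p z q r \<noteq> 0" "concyclic_det z p q r \<noteq> 0"
    if "concyclic_det p q r z \<noteq> 0" for p q r z
    using that concyclic_det_perm(3)[of p q r z] concyclic_det_perm(2)[of p q z r]
      concyclic_det_perm(1)[of p z q r] by simp_all
  have con31: "concyclic_det p q r (s + v) \<noteq> 0"
    and con13: "concyclic_det (p + v) (q + v) (r + v) s \<noteq> 0"
    if "p \<in> P" "q \<in> P" "r \<in> P" "s \<in> P" "distinct [p, q, r]" for p q r s
  proof -
    show "concyclic_det p q r (s + v) \<noteq> 0" using v that by blast
    have "concyclic_det p q r (s - v) \<noteq> 0" using v that by blast
    then show "concyclic_det (p + v) (q + v) (r + v) s \<noteq> 0"
      using concyclic_det_translate[of p v q r "s - v"] by simp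
  qed
  have con22: "concyclic_det p q (r + v) (s + v) \<noteq> 0" "concyclic_det p (r + v) q (s + v) \<noteq> 0"
      "concyclic_det p (r + v) (s + v) q \<noteq> 0" "concyclic_det (r + v) p q (s + v) \<noteq> 0"
      "concyclic_det (r + v) p (s + v) q \<noteq> 0" "concyclic_det (r + v) (s + v) p q \<noteq> 0"
    if "p \<in> P" "q \<in> P" "r \<in> P" "s \<in> P" "p \<noteq> q" "r \<noteq> s" for p q r s
  proof -
    show 1: "concyclic_det p q (r + v) (s + v) \<noteq> 0" using v that by blast
    then show 2: "concyclic_det p (r + v) q (s + v) \<noteq> 0"
      using concyclic_det_perm(2)[of p q "r + v" "s + v"] by simp
    then show 3: "concyclic_det p (r + v) (s + v) q \<noteq> 0"
      using concyclic_det_perm(3)[of p "r + v" q "s + v"] by simp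
    show "concyclic_det (r + v) p q (s + v) \<noteq> 0"
      using 2 concyclic_det_perm(1)[of p "r + v" q "s + v"] by simp
    show 4: "concyclic_det (r + v) p (s + v) q \<noteq> 0"
      using 3 concyclic_det_perm(1)[of p "r + v" "s + v" q] by simp
    then show "concyclic_det (r + v) (s + v) p q \<noteq> 0"
      using concyclic_det_perm(2)[of "r + v" p "s + v" q] by simp
  qed
  show ?thesis
    unfolding det_general_position_def
  proof (intro conjI ballI impI)
    fix p q r
    assume "p \<in> P \<union> (\<lambda>p. p + v) ` P" "q \<in> P \<union> (\<lambda>p. p + v) ` P" "r \<in> P \<union> (\<lambda>p. p + v) ` P"
      and "distinct [p, q, r]"
    then show "collinear_det p q r \<noteq> 0"
      by (elim UnE imageE) (simp_all add: collinear_det_translate col3 col21 col12)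
  next
    fix p q r s
    assume "p \<in> P \<union> (\<lambda>p. p + v) ` P" "q \<in> P \<union> (\<lambda>p. p + v) ` P" "r \<in> P \<union> (\<lambda>p. p + v) ` P"
        "s \<in> P \<union> (\<lambda>p. p + v) ` P"
      and "distinct [p, q, r, s]"
    \<comment> \<open>The 16 goals appear in binary order, unshifted before shifted, with
      \<open>s\<close> varying fastest; the facts are listed in that order.\<close>
    then show "concyclic_det p q r s \<noteq> 0"
      by (elim UnE imageE,
          simp add: con4, simp add: con31,
          simp add: con31[THEN move_last(1)], simp add: con22(1),
          simp add: con31[THEN move_last(2)], simp add: con22(2),
          simp add: con22(3), simp add: con13[THEN move_last(3)],
          simp add: con31[THEN move_last(3)], simp add: con22(4),
          simp add: con22(5), simp add: con13[THEN move_last(2)],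
          simp add: con22(6), simp add: con13[THEN move_last(1)],
          simp add: con13, simp add: con4 concyclic_det_translate)
  qed
qed

section \<open>Growth of the number of difference pairs\<close>

lemma card_difference_pairs_double:
  assumes "finite P"
  shows "card (difference_pairs (P \<union> (\<lambda>p. p + v) ` P)) \<le> 7 * card (difference_pairs P)"
proof -
  \<comment> \<open>The values of (i - j, k - j) for i, j, k in {0, v}: eight choices, of which i =
    j = k = 0 and i = j = k = v both give (0, 0).\<close>
  define S where "S = {(0, 0), (0, v), (v, 0), (v, v), (0, - v), (- v, 0), (- v, - v)}"
  have "difference_pairs (P \<union> (\<lambda>p. p + v) ` P) \<subseteq>
      (\<lambda>(s, a). s + a) ` (S \<times> difference_pairs P)"
  proof
    fix x assume "x \<in> difference_pairs (P \<union> (\<lambda>p. p + v) ` P)"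
    then obtain p q r where x: "x = (p - q, r - q)"
      and pqr: "p \<in> P \<union> (\<lambda>p. p + v) ` P" "q \<in> P \<union> (\<lambda>p. p + v) ` P" "r \<in> P \<union> (\<lambda>p. p + v) ` P"
      unfolding difference_pairs_def by auto
    have shift: "\<exists>p'\<in>P. \<exists>i\<in>{0, v}. p = p' + i" if "p \<in> P \<union> (\<lambda>p. p + v) ` P" for p
      using that by auto
    obtain p' i where p: "p' \<in> P" "i \<in> {0, v}" "p = p' + i" using shift[OF pqr(1)] by blast
    obtain q' j where q: "q' \<in> P" "j \<in> {0, v}" "q = q' + j" using shift[OF pqr(2)] by blast
    obtain r' k where r: "r' \<in> P" "k \<in> {0, v}" "r = r' + k" using shift[OF pqr(3)] by blast
    have "(i - j, k - j) \<in> S" using p(2) q(2) r(2) by (elim insertE emptyE) (simp_all add: S_def)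
    moreover have "(p' - q', r' - q') \<in> difference_pairs P"
      unfolding difference_pairs_def
      using p q r by (intro image_eqI[where x = "(p', q', r')"]) simp_all
    moreover have "x = (i - j, k - j) + (p' - q', r' - q')"
      using p q r x by simp
    ultimately show "x \<in> (\<lambda>(s, a). s + a) ` (S \<times> difference_pairs P)"
      by (intro image_eqI[where x = "((i - j, k - j), (p' - q', r' - q'))"]) simp_all
  qed
  moreover have fin: "finite (S \<times> difference_pairs P)"
    using assms by (simp add: S_def difference_pairs_def)
  ultimately have "card (difference_pairs (P \<union> (\<lambda>p. p + v) ` P)) \<le> card (S \<times> difference_pairs P)"
    by (metis (no_types, lifting) card_image_le card_mono finite_imageI le_trans)
  also have "\<dots> = card S * card (difference_pairs P)"
    by (rule card_cartesian_product)
  \<comment> \<open>Only an upper bound is taken, since the listed pairs may coincide, for instance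
    when v = 0.\<close>
  also have "card S \<le> length [(0, 0), (0, v), (v, 0), (v, v), (0, - v), (- v, 0), (- v, - v)]"
    unfolding S_def by (rule order_trans[OF _ card_length]) simp
  finally show ?thesis by simp
qed

lemma exists_few_difference_pairs:
  "\<exists>P :: (real^2) set. finite P \<and> card P = 2 ^ d \<and> det_general_position P \<and>
     card (difference_pairs P) \<le> 7 ^ d"
proof (induction d)
  case 0
  show ?case
    by (intro exI[of _ "{0}"]) (simp add: det_general_position_def difference_pairs_def)
next
  case (Suc d)
  then obtain P :: "(real^2) set" where P: "finite P" "card P = 2 ^ d" "det_general_position P"
    "card (difference_pairs P) \<le> 7 ^ d" by blast
  then obtain v where v: "generic_shift P v" using exists_generic_shift by blast
  have "card ((\<lambda>p. p + v) ` P) = 2 ^ d" using P by (simp add: card_image)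
  moreover have "P \<inter> (\<lambda>p. p + v) ` P = {}" using v by (auto simp: generic_shift_def)
  ultimately have "card (P \<union> (\<lambda>p. p + v) ` P) = 2 ^ Suc d"
    using P by (simp add: card_Un_disjoint)
  moreover have "card (difference_pairs (P \<union> (\<lambda>p. p + v) ` P)) \<le> 7 ^ Suc d"
    using card_difference_pairs_double[OF P(1), of v] P(4) by simp
  ultimately show ?case
    using P det_general_position_double[OF P(3) v] by (intro exI[of _ "P \<union> (\<lambda>p. p + v) ` P"]) simp
qed

section \<open>From difference pairs to the angle bound\<close>

lemma num_angles_le:
  assumes "finite P"
  shows "num_angles P \<le> card (difference_pairs P)"
proof -
  have "angle_set P \<subseteq> (\<lambda>(a, b). arccos ((a \<bullet> b) / (norm a * norm b))) ` difference_pairs P"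
    unfolding angle_set_def difference_pairs_def angle_def by force
  moreover have "finite (difference_pairs P)" using assms by (simp add: difference_pairs_def)
  ultimately show ?thesis
    unfolding num_angles_def using surj_card_le by blast
qed

lemma general_position_subset:
  "general_position P \<Longrightarrow> Q \<subseteq> P \<Longrightarrow> general_position Q"
  unfolding general_position_def by (meson subset_trans)

text \<open>For \<open>n\<close> that is not a power of 2, pass to an \<open>n\<close>-point subset
  of the 2^d points: it stays in general position and its difference pairs are among the old
  ones.\<close>

lemma A_gen_le:
  assumes "n \<le> 2 ^ d"
  shows "A_gen n \<le> 7 ^ d"
proof -
  obtain P :: "(real^2) set" where P: "finite P" "card P = 2 ^ d" "det_general_position P"
    "card (difference_pairs P) \<le> 7 ^ d" using exists_few_difference_pairs by blast
  obtain Q where Q: "Q \<subseteq> P" "card Q = n" "finite Q"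
    using obtain_subset_with_card_n[of n P] assms P by auto
  have "general_position Q"
    using general_position_subset det_general_position_imp P Q by blast
  then have "A_gen n \<le> num_angles Q"
    unfolding A_gen_def using Q by (intro cInf_lower) auto
  also have "\<dots> \<le> card (difference_pairs Q)" using num_angles_le Q by blast
  also have "\<dots> \<le> card (difference_pairs P)"
    using Q P unfolding difference_pairs_def by (intro card_mono image_mono Sigma_mono) auto
  finally show ?thesis using P by simp
qed

theorem theorem2p14:
  shows "(\<lambda>n. real (A_gen n)) \<in> O(\<lambda>n. real n powr log 2 7)"
proof (rule bigoI)
  show "\<forall>\<^sub>F n in sequentially. norm (real (A_gen n)) \<le> 7 * norm (real n powr log 2 7)"
  proof (rule eventually_sequentiallyI[of 1])
    fix n :: nat assume n: "1 \<le> n"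
    \<comment> \<open>Rounding up raises the exponent by at most 1, which costs the constant 7. As n
      \<ge> 1 the logarithm is nonnegative, so \<open>nat\<close> does not truncate.\<close>
    define d where "d = nat \<lceil>log 2 (real n)\<rceil>"
    have d: "log 2 (real n) \<le> real d" "real d \<le> log 2 (real n) + 1"
      using n by (auto simp: d_def)
    have "real n \<le> 2 powr real d"
      using d n by (simp add: log_le_iff)
    then have "real n \<le> real (2 ^ d)" by (simp add: powr_realpow)
    then have "n \<le> 2 ^ d" by (simp only: of_nat_le_iff)
    then have "real (A_gen n) \<le> real (7 ^ d)"
      using A_gen_le of_nat_mono by blast
    also have "\<dots> = 7 powr real d" by (simp add: powr_realpow)
    also have "\<dots> \<le> 7 powr (log 2 (real n) + 1)" using d by simp
    also have "\<dots> = 7 * 7 powr log 2 (real n)" by (simp add: powr_add)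
    \<comment> \<open>Both sides are exp (ln 7 ln n / ln 2).\<close>
    also have "7 powr log 2 (real n) = real n powr log 2 7"
      using n by (simp add: powr_def log_def)
    finally show "norm (real (A_gen n)) \<le> 7 * norm (real n powr log 2 7)" by simp
  qed
qed

end
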